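(* Let $X,Y$ be real Hilbert spaces, $A\in L(X,Y)$, $y^\delta\in Y$ with $y^\delta\ne0$, $\alpha>0$, and let $R\colon X\to[0,\infty]$ be convex, coercive and weakly lower semicontinuous with $R\not\equiv\infty$. Assume that the functional $$\tilde R(x)=\min_{v\in\partial R(x)}\langle v,x\rangle$$ is well-defined. If $\tilde R$ is weakly lower semicontinuous, then there exists a solution of the ADP problem $$\min_{B\in L(X,Y)}\ \frac12\|Ax(B)-y^\delta\|^2\quad\text{s.t.}\quad x(B)=\arg\min_{x\in X}\frac12\|Bx-y^\delta\|^2+\alpha R(x).$$
   Context: $L(X,Y)$ is the space of bounded linear operators. $\partial R(x)=\{v\in X:R(z)\ge R(x)+\langle v,z-x\rangle\ \forall z\in X\}$ if $R(x)<\infty$, and $\partial R(x)=\emptyset$ otherwise. "Well-defined" means the minimum defining $\tilde R(x)$ is attained whenever $\partial R(x)\neq\emptyset$; $\tilde R(x)=+\infty$ if $\partial R(x)=\emptyset$. A solution of the ADP problem is an element $\hat x$ minimizing $\frac12\|Ax-y^\delta\|^2$ over the set of all $x\in X$ that are minimizers of $z\mapsto\frac12\|Bz-y^\delta\|^2+\alpha R(z)$ for some $B\in L(X,Y)$. *)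

theory Defs
  imports "HOL-Analysis.Analysis"
begin

text \<open>Functionals with values in \<open>[0,\<infinity>]\<close> are modelled as \<^typ>\<open>ereal\<close>-valued functions with an
  explicit nonnegativity assumption.\<close>

definition convex_functional :: "('a::real_vector \<Rightarrow> ereal) \<Rightarrow> bool" where
  "convex_functional F \<longleftrightarrow>
     (\<forall>x y. \<forall>t::real. 0 < t \<and> t < 1 \<longrightarrow>
        F ((1 - t) *\<^sub>R x + t *\<^sub>R y) \<le> ereal (1 - t) * F x + ereal t * F y)"

definition coercive :: "('a::real_normed_vector \<Rightarrow> ereal) \<Rightarrow> bool" where
  "coercive F \<longleftrightarrow> (F \<longlongrightarrow> \<infinity>) at_infinity"

definition weakly_converges :: "(nat \<Rightarrow> 'a::real_inner) \<Rightarrow> 'a \<Rightarrow> bool" where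
  "weakly_converges s x \<longleftrightarrow> (\<forall>u. (\<lambda>n. s n \<bullet> u) \<longlonglongrightarrow> x \<bullet> u)"

text \<open>Semicontinuity is sequential, as usual in regularization theory. Lower semicontinuity with
  respect to the weak topology implies it, and the two agree for convex functionals.\<close>

definition weakly_lsc :: "('a::real_inner \<Rightarrow> ereal) \<Rightarrow> bool" where
  "weakly_lsc F \<longleftrightarrow>
     (\<forall>s x. weakly_converges s x \<longrightarrow> F x \<le> liminf (\<lambda>n. F (s n)))"

definition subdifferential :: "('a::real_inner \<Rightarrow> ereal) \<Rightarrow> 'a \<Rightarrow> 'a set" where
  "subdifferential R x =
     (if R x < \<infinity> then {v. \<forall>z. R z \<ge> R x + ereal (v \<bullet> (z - x))} else {})"

text \<open>The infimum over the empty set is \<open>\<infinity>\<close> in \<^typ>\<open>ereal\<close>; elsewhere it is a minimum exactly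
  under \<open>R_tilde_well_defined\<close>.\<close>

definition R_tilde :: "('a::real_inner \<Rightarrow> ereal) \<Rightarrow> 'a \<Rightarrow> ereal" where
  "R_tilde R x = (INF v\<in>subdifferential R x. ereal (v \<bullet> x))"

definition R_tilde_well_defined :: "('a::real_inner \<Rightarrow> ereal) \<Rightarrow> bool" where
  "R_tilde_well_defined R \<longleftrightarrow>
     (\<forall>x. subdifferential R x \<noteq> {} \<longrightarrow>
        (\<exists>v. is_arg_min (\<lambda>w. w \<bullet> x) (\<lambda>w. w \<in> subdifferential R x) v))"

definition tikhonov ::
  "real \<Rightarrow> ('a::real_inner \<Rightarrow> ereal) \<Rightarrow> 'b::real_inner \<Rightarrow> ('a \<Rightarrow>\<^sub>L 'b) \<Rightarrow> 'a \<Rightarrow> ereal" where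
  "tikhonov \<alpha> R y B z = ereal (1/2 * (norm (blinfun_apply B z - y))\<^sup>2) + ereal \<alpha> * R z"

definition adp_feasible ::
  "real \<Rightarrow> ('a::real_inner \<Rightarrow> ereal) \<Rightarrow> 'b::real_inner \<Rightarrow> 'a \<Rightarrow> bool" where
  "adp_feasible \<alpha> R y x \<longleftrightarrow>
     (\<exists>B :: 'a \<Rightarrow>\<^sub>L 'b. is_arg_min (tikhonov \<alpha> R y B) (\<lambda>_. True) x)"

definition adp_solution ::
  "('a::real_inner \<Rightarrow>\<^sub>L 'b::real_inner) \<Rightarrow> real \<Rightarrow> ('a \<Rightarrow> ereal) \<Rightarrow> 'b \<Rightarrow> 'a \<Rightarrow> bool" where
  "adp_solution A \<alpha> R y =
     is_arg_min (\<lambda>x. 1/2 * (norm (blinfun_apply A x - y))\<^sup>2) (adp_feasible \<alpha> R y)"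

end

theory Submission
  imports Defs "HOL-Library.Diagonal_Subsequence"
begin

text \<open>Whether \<open>x\<close> is feasible can be read off from \<open>R_tilde R\<close> alone: \<open>x\<close> minimizes some Tikhonov
  functional iff \<open>R_tilde R x \<le> \<parallel>y\<parallel>\<^sup>2 / (4 \<alpha>)\<close> (\<open>adp_feasible_iff_R_tilde\<close>). Since \<open>R_tilde R\<close> is weakly
  lower semicontinuous, the feasible set is weakly sequentially closed, and the solution is obtained
  by the direct method: the residual \<open>\<parallel>A x - y\<parallel>\<^sup>2 / 2\<close> is weakly lower semicontinuous, and bounded
  sequences in a Hilbert space have weakly convergent subsequences.

  It remains to see that the feasible set is nonempty and bounded. If \<open>R 0\<close> is finite, the subgradient
  inequality at the origin gives \<open>R x \<le> R 0 + R_tilde R x\<close>, so that coercivity bounds the feasible set.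
  Finiteness of \<open>R 0\<close> is not assumed but follows from the hypotheses on \<open>R_tilde R\<close>
  (\<open>R_tilde_zero_le\<close>): the minimizers \<open>x\<^sub>\<epsilon>\<close> of \<open>\<parallel>x\<parallel>\<^sup>2 / 2 + \<epsilon> R x\<close> satisfy
  \<open>R_tilde R x\<^sub>\<epsilon> \<le> - \<parallel>x\<^sub>\<epsilon>\<parallel>\<^sup>2 / \<epsilon>\<close>. Were they bounded away from the origin as \<open>\<epsilon> \<rightarrow> 0\<close>, semicontinuity would
  give \<open>R_tilde R\<close> the value \<open>-\<infinity>\<close> at a weak limit, which attainment of the minimum excludes. So a
  subsequence tends to the origin, and semicontinuity there yields \<open>R_tilde R 0 \<le> 0\<close>. Hence \<open>R\<close> has a
  subgradient at the origin, and the origin is feasible.\<close>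

section \<open>Weak sequential compactness in Hilbert spaces\<close>

text \<open>Orthogonal projection: a minimizing sequence for the distance is Cauchy by the
  parallelogram law.\<close>

lemma closed_subspace_orthogonal_projection:
  fixes V :: "'a::{real_inner, complete_space} set" and u :: 'a
  assumes sub: "subspace V" and cl: "closed V"
  obtains p where "p \<in> V" and "\<And>v. v \<in> V \<Longrightarrow> (u - p) \<bullet> v = 0"
proof -
  define D where "D = (INF v\<in>V. (norm (u - v))\<^sup>2)"
  have ne: "V \<noteq> {}" using subspace_0[OF sub] by auto
  have bdd: "bdd_below ((\<lambda>v. (norm (u - v))\<^sup>2) ` V)" by (rule bdd_belowI[of _ 0]) auto
  have D_le: "D \<le> (norm (u - v))\<^sup>2" if "v \<in> V" for v
    unfolding D_def by (rule cINF_lower[OF bdd that])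
  have "\<exists>v\<in>V. (norm (u - v))\<^sup>2 < D + inverse (real (Suc n))" for n
    using cINF_less_iff[OF ne bdd, of "D + inverse (real (Suc n))"] by (simp add: D_def)
  then obtain p where pV: "\<And>n. p n \<in> V"
    and p: "\<And>n. (norm (u - p n))\<^sup>2 < D + inverse (real (Suc n))" by metis
  have close: "(norm (p m - p n))\<^sup>2 \<le> 2 * inverse (real (Suc m)) + 2 * inverse (real (Suc n))" for m n
  proof -
    have "(1/2) *\<^sub>R (p m + p n) \<in> V"
      using pV sub by (intro subspace_mul subspace_add)
    from D_le[OF this]
    have *: "4 * D \<le> 4 * (norm (u - (1/2) *\<^sub>R (p m + p n)))\<^sup>2" by simp
    have "(norm (p m - p n))\<^sup>2 + 4 * (norm (u - (1/2) *\<^sub>R (p m + p n)))\<^sup>2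
        = 2 * (norm (u - p m))\<^sup>2 + 2 * (norm (u - p n))\<^sup>2"
      unfolding power2_norm_eq_inner
      by (simp add: inner_simps inner_commute algebra_simps)
    with * p[of m] p[of n] show ?thesis by linarith
  qed
  have "Cauchy p"
  proof (rule metric_CauchyI)
    fix e :: real assume "e > 0"
    then have "e\<^sup>2 / 4 > 0" by simp
    then obtain N where N: "inverse (real (Suc N)) < e\<^sup>2 / 4" using reals_Archimedean by blast
    have "dist (p m) (p n) < e" if "m \<ge> N" "n \<ge> N" for m n
    proof -
      have "inverse (real (Suc m)) \<le> inverse (real (Suc N))" "inverse (real (Suc n)) \<le> inverse (real (Suc N))"
        using that by (auto intro!: le_imp_inverse_le)
      with close[of m n] N have "(norm (p m - p n))\<^sup>2 < e\<^sup>2" by linarith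
      then show ?thesis using \<open>e > 0\<close> by (simp add: dist_norm power2_less_imp_less)
    qed
    then show "\<exists>M. \<forall>m\<ge>M. \<forall>n\<ge>M. dist (p m) (p n) < e" by blast
  qed
  then obtain q where q: "p \<longlonglongrightarrow> q" using Cauchy_convergent convergent_def by blast
  have qV: "q \<in> V" using closed_sequentially[OF cl pV q] .
  have "(\<lambda>n. (norm (u - p n))\<^sup>2) \<longlonglongrightarrow> (norm (u - q))\<^sup>2" by (intro tendsto_intros q)
  moreover have "(\<lambda>n. D + inverse (real (Suc n))) \<longlonglongrightarrow> D + 0"
    by (intro tendsto_intros LIMSEQ_inverse_real_of_nat)
  ultimately have qD: "(norm (u - q))\<^sup>2 \<le> D + 0"
    by (rule LIMSEQ_le) (use p less_imp_le in blast)
  have "(u - q) \<bullet> v = 0" if v: "v \<in> V" for v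
  proof (cases "v = 0")
    case False
    define t where "t = ((u - q) \<bullet> v) / (v \<bullet> v)"
    have "q + t *\<^sub>R v \<in> V" using qV v sub by (intro subspace_mul subspace_add)
    from D_le[OF this] qD have "(norm (u - q))\<^sup>2 \<le> (norm (u - (q + t *\<^sub>R v)))\<^sup>2" by linarith
    also have "\<dots> = (norm (u - q))\<^sup>2 - 2 * t * ((u - q) \<bullet> v) + t * t * (v \<bullet> v)"
      unfolding power2_norm_eq_inner by (simp add: inner_simps inner_commute algebra_simps)
    also have "\<dots> = (norm (u - q))\<^sup>2 - ((u - q) \<bullet> v)\<^sup>2 / (v \<bullet> v)"
      using False unfolding t_def by (simp add: field_simps power2_eq_square)
    finally have "((u - q) \<bullet> v)\<^sup>2 / (v \<bullet> v) \<le> 0" by simp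
    then show ?thesis using False
      by (smt (verit) inner_gt_zero_iff divide_pos_pos zero_less_power2)
  qed simp
  with qV show thesis by (rule that)
qed

lemma riesz_representation:
  fixes f :: "'a::{real_inner, complete_space} \<Rightarrow> real"
  assumes "bounded_linear f"
  obtains z where "\<And>u. f u = z \<bullet> u"
proof (cases "\<forall>u. f u = 0")
  case True
  then show thesis using that[of 0] by simp
next
  case False
  interpret f: bounded_linear f by fact
  obtain u where u: "f u \<noteq> 0" using False by blast
  let ?V = "{u. f u = 0}"
  have "subspace ?V" by (auto simp: subspace_def f.add f.scaleR f.zero)
  moreover have "closed ?V"
    by (intro closed_Collect_eq continuous_intros linear_continuous_on assms)
  ultimately obtain p where p: "f p = 0" "\<And>v. f v = 0 \<Longrightarrow> (u - p) \<bullet> v = 0"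
    by (rule closed_subspace_orthogonal_projection[of ?V u]) auto
  define w where "w = u - p"
  have fw: "f w = f u" using p by (simp add: w_def f.diff)
  then have w0: "w \<noteq> 0" using u f.zero by auto
  have "f v = ((f u / (w \<bullet> w)) *\<^sub>R w) \<bullet> v" for v
  proof -
    have "f (v - (f v / f u) *\<^sub>R w) = 0" using u fw by (simp add: f.diff f.scaleR)
    from p(2)[OF this] have "w \<bullet> v = f v / f u * (w \<bullet> w)" by (simp add: w_def inner_simps)
    then show ?thesis using w0 u by (simp add: field_simps)
  qed
  then show thesis by (rule that)
qed

text \<open>A diagonal argument makes \<open>\<langle>s\<^sub>n, s\<^sub>k\<rangle>\<close> converge in \<open>n\<close> for every \<open>k\<close>. The vectors \<open>u\<close> for which
  \<open>\<langle>s\<^sub>n, u\<rangle>\<close> converges then form a closed subspace containing all \<open>s\<^sub>k\<close>, and vectors orthogonal to it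
  belong to it trivially, so it is the whole space and separability is not needed. The limit
  functional is represented by the weak limit.\<close>

lemma bounded_imp_weakly_convergent_subsequence:
  fixes s :: "nat \<Rightarrow> 'a::{real_inner, complete_space}"
  assumes "bounded (range s)"
  obtains r x where "strict_mono r" and "weakly_converges (s \<circ> r) x"
proof -
  obtain M where M: "\<And>n. norm (s n) \<le> M" using assms by (auto simp: bounded_iff)
  have M0: "M \<ge> 0" using M[of 0] norm_ge_zero order_trans by blast
  define P where "P = (\<lambda>k r. convergent (\<lambda>n. s (r n) \<bullet> s k))"
  interpret subseqs P
  proof
    fix k and q :: "nat \<Rightarrow> nat"
    have "\<bar>s (q n) \<bullet> s k\<bar> \<le> M * M" for n
      by (rule order_trans[OF Cauchy_Schwarz_ineq2]) (intro mult_mono M M0 norm_ge_zero)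
    then have "bounded (range (\<lambda>n. s (q n) \<bullet> s k))" by (auto simp: bounded_iff)
    then obtain l r where "strict_mono r" "((\<lambda>n. s (q n) \<bullet> s k) \<circ> r) \<longlonglongrightarrow> l"
      using bounded_imp_convergent_subsequence by blast
    then show "\<exists>r'. strict_mono r' \<and> P k (q \<circ> r')"
      by (auto simp: P_def o_def convergent_def)
  qed
  define t where "t = s \<circ> diagseq"
  have tM: "norm (t n) \<le> M" for n using M by (simp add: t_def)
  have conv_s: "convergent (\<lambda>n. t n \<bullet> s k)" for k
  proof -
    have "P k (diagseq \<circ> (+) (Suc k))"
    proof (rule diagseq_holds)
      fix r q :: "nat \<Rightarrow> nat" and n assume "strict_mono r" "P n q"
      then show "P n (q \<circ> r)"
        using convergent_subseq_convergent[of "\<lambda>i. s (q i) \<bullet> s n" r] by (simp add: P_def o_def)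
    qed
    then have "convergent (\<lambda>n. t (n + Suc k) \<bullet> s k)"
      by (simp add: P_def t_def o_def add.commute)
    then show ?thesis using convergent_ignore_initial_segment[of "\<lambda>n. t n \<bullet> s k" "Suc k"] by simp
  qed
  define V where "V = {u. convergent (\<lambda>n. t n \<bullet> u)}"
  have subV: "subspace V"
    unfolding subspace_def V_def
    by (auto simp: inner_simps intro: convergent_add convergent_mult convergent_const)
  have "closed V"
  proof (rule closure_subset_eq[THEN iffD1], rule subsetI)
    fix u assume u: "u \<in> closure V"
    have "Cauchy (\<lambda>n. t n \<bullet> u)"
    proof (rule metric_CauchyI)
      fix e :: real assume e: "e > 0"
      then have "e / (3 * (M + 1)) > 0" using M0 by simp
      then obtain v where v: "v \<in> V" "dist v u < e / (3 * (M + 1))"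
        using u closure_approachable by blast
      have small: "\<bar>t n \<bullet> u - t n \<bullet> v\<bar> < e / 3" for n
      proof -
        have "\<bar>t n \<bullet> u - t n \<bullet> v\<bar> \<le> norm (t n) * norm (u - v)"
          using Cauchy_Schwarz_ineq2[of "t n" "u - v"] by (simp add: inner_simps)
        also have "\<dots> \<le> (M + 1) * norm (u - v)"
          using tM[of n] by (intro mult_right_mono) auto
        also have "\<dots> < e / 3"
          using v(2) M0 by (simp add: dist_norm norm_minus_commute field_simps)
        finally show ?thesis .
      qed
      have "Cauchy (\<lambda>n. t n \<bullet> v)" using v by (simp add: V_def convergent_Cauchy)
      then obtain N where N: "\<And>m n. m \<ge> N \<Longrightarrow> n \<ge> N \<Longrightarrow> dist (t m \<bullet> v) (t n \<bullet> v) < e / 3"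
        using e metric_CauchyD[of "\<lambda>n. t n \<bullet> v" "e/3"] by fastforce
      have "dist (t m \<bullet> u) (t n \<bullet> u) < e" if "m \<ge> N" "n \<ge> N" for m n
        using N[OF that] small[of m] small[of n] unfolding dist_real_def by linarith
      then show "\<exists>N. \<forall>m\<ge>N. \<forall>n\<ge>N. dist (t m \<bullet> u) (t n \<bullet> u) < e" by blast
    qed
    then show "u \<in> V" by (simp add: V_def Cauchy_convergent)
  qed
  have conv: "convergent (\<lambda>n. t n \<bullet> u)" for u
  proof -
    obtain p where p: "p \<in> V" "\<And>v. v \<in> V \<Longrightarrow> (u - p) \<bullet> v = 0"
      using closed_subspace_orthogonal_projection[OF subV \<open>closed V\<close>] by blast
    have "t n \<in> V" for n using conv_s by (simp add: V_def t_def)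
    then have "t n \<bullet> u = t n \<bullet> p" for n
      using p(2)[of "t n"] by (simp add: inner_simps inner_commute)
    with p(1) show ?thesis by (simp add: V_def)
  qed
  define f where "f u = lim (\<lambda>n. t n \<bullet> u)" for u
  have f: "(\<lambda>n. t n \<bullet> u) \<longlonglongrightarrow> f u" for u
    using conv convergent_LIMSEQ_iff unfolding f_def by blast
  have "bounded_linear f"
  proof (rule bounded_linear_intro[where K = M])
    show "f (u + v) = f u + f v" for u v
      using tendsto_add[OF f[of u] f[of v]]
      by (intro LIMSEQ_unique[OF f[of "u + v"]]) (simp add: inner_simps)
    show "f (c *\<^sub>R u) = c *\<^sub>R f u" for c u
      using tendsto_mult_left[OF f[of u], of c]
      by (intro LIMSEQ_unique[OF f[of "c *\<^sub>R u"]]) (simp add: inner_simps)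
    show "norm (f u) \<le> norm u * M" for u
    proof (rule Lim_bounded[OF tendsto_norm[OF f[of u]], of 0], safe)
      fix n
      show "norm (t n \<bullet> u) \<le> norm u * M"
        using Cauchy_Schwarz_ineq2[of "t n" u] mult_right_mono[OF tM[of n] norm_ge_zero[of u]]
        by (simp add: mult.commute)
    qed
  qed
  then obtain x where x: "\<And>u. f u = x \<bullet> u" by (rule riesz_representation) blast
  have "weakly_converges (s \<circ> diagseq) x"
    using f unfolding weakly_converges_def t_def by (simp add: x)
  then show thesis using subseq_diagseq by (rule that[rotated])
qed

section \<open>Weakly lower semicontinuous functionals and the direct method\<close>

lemma coercive_imp_bounded_sublevel:
  assumes "coercive F"
  shows "bounded {x. F x \<le> ereal c}"
proof -
  have "\<forall>\<^sub>F x in at_infinity. ereal c < F x"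
    using assms order_tendstoD(1)[of F \<infinity> at_infinity "ereal c"] by (simp add: coercive_def)
  then obtain b where "\<And>x. b \<le> norm x \<Longrightarrow> ereal c < F x" by (auto simp: eventually_at_infinity)
  then have "norm x \<le> b" if "F x \<le> ereal c" for x using that by (meson leD linear)
  then show ?thesis by (auto simp: bounded_iff)
qed

lemma weakly_lsc_imp_minimizer_on_sublevel:
  fixes F G :: "'a::{real_inner, complete_space} \<Rightarrow> ereal"
  assumes F: "weakly_lsc F" and G: "weakly_lsc G"
    and bdd: "bounded {x. G x \<le> c}" and ne: "G z \<le> c"
  obtains x where "G x \<le> c" and "\<And>z. G z \<le> c \<Longrightarrow> F x \<le> F z"
proof -
  let ?S = "{x. G x \<le> c}"
  have "F ` ?S \<noteq> {}" using ne by auto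
  from Inf_as_limit[OF this] obtain u
    where u: "\<And>n. u n \<in> F ` ?S" "u \<longlonglongrightarrow> Inf (F ` ?S)" by blast
  then have "\<forall>n. \<exists>x. G x \<le> c \<and> u n = F x" by blast
  then obtain s where s: "\<And>n. G (s n) \<le> c" "\<And>n. u n = F (s n)" by metis
  have "bounded (range s)" by (rule bounded_subset[OF bdd]) (use s in auto)
  then obtain r x where r: "strict_mono r" and x: "weakly_converges (s \<circ> r) x"
    by (rule bounded_imp_weakly_convergent_subsequence)
  have "G x \<le> liminf (\<lambda>n. G ((s \<circ> r) n))" using G x unfolding weakly_lsc_def by blast
  also have "\<dots> \<le> liminf (\<lambda>n. c)" by (intro Liminf_mono always_eventually) (simp add: s)
  finally have Gx: "G x \<le> c" by (simp add: Liminf_const)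
  have "(\<lambda>n. F ((s \<circ> r) n)) \<longlonglongrightarrow> Inf (F ` ?S)"
    using LIMSEQ_subseq_LIMSEQ[OF u(2) r] by (simp add: o_def s)
  then have "liminf (\<lambda>n. F ((s \<circ> r) n)) = Inf (F ` ?S)" by (intro lim_imp_Liminf) auto
  moreover have "F x \<le> liminf (\<lambda>n. F ((s \<circ> r) n))" using F x unfolding weakly_lsc_def by blast
  ultimately have "F x \<le> F z" if "G z \<le> c" for z
    using that by (metis (mono_tags, lifting) INF_lower mem_Collect_eq order_trans)
  with Gx show thesis by (rule that)
qed

text \<open>The squared norm lies above its tangent at the weak limit, and the tangent is weakly
  continuous.\<close>

lemma weakly_lsc_residual:
  fixes B :: "'a::{real_inner, complete_space} \<Rightarrow>\<^sub>L 'b::real_inner"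
  shows "weakly_lsc (\<lambda>x. ereal (1/2 * (norm (blinfun_apply B x - y))\<^sup>2))"
  unfolding weakly_lsc_def
proof (intro allI impI)
  fix s and x :: 'a assume s: "weakly_converges s x"
  define w where "w = blinfun_apply B x - y"
  have "bounded_linear (\<lambda>u. blinfun_apply B u \<bullet> w)"
    by (intro bounded_linear_inner_left_comp blinfun.bounded_linear_right)
  then obtain z where z: "\<And>u. blinfun_apply B u \<bullet> w = z \<bullet> u" by (rule riesz_representation) blast
  define g where "g n = (blinfun_apply B (s n) - y) \<bullet> w - 1/2 * (w \<bullet> w)" for n
  have "(\<lambda>n. s n \<bullet> z - y \<bullet> w - 1/2 * (w \<bullet> w)) \<longlonglongrightarrow> x \<bullet> z - y \<bullet> w - 1/2 * (w \<bullet> w)"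
    using s unfolding weakly_converges_def by (intro tendsto_diff tendsto_const) blast
  moreover have "x \<bullet> z = y \<bullet> w + w \<bullet> w"
    using z[of x] by (simp add: w_def inner_simps inner_commute)
  moreover have "g = (\<lambda>n. s n \<bullet> z - y \<bullet> w - 1/2 * (w \<bullet> w))"
    unfolding g_def fun_eq_iff inner_diff_left z by (simp add: inner_commute)
  ultimately have "g \<longlonglongrightarrow> 1/2 * (norm w)\<^sup>2"
    by (simp add: power2_norm_eq_inner)
  then have "(\<lambda>n. ereal (g n)) \<longlonglongrightarrow> ereal (1/2 * (norm w)\<^sup>2)" by simp
  then have "ereal (1/2 * (norm w)\<^sup>2) = liminf (\<lambda>n. ereal (g n))"
    by (intro lim_imp_Liminf[symmetric]) auto
  also have "\<dots> \<le> liminf (\<lambda>n. ereal (1/2 * (norm (blinfun_apply B (s n) - y))\<^sup>2))"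
  proof (intro Liminf_mono always_eventually allI)
    fix n
    have "0 \<le> (norm (blinfun_apply B (s n) - y - w))\<^sup>2" by simp
    then show "ereal (g n) \<le> ereal (1/2 * (norm (blinfun_apply B (s n) - y))\<^sup>2)"
      unfolding g_def power2_norm_eq_inner
      by (simp only: inner_diff_left inner_diff_right inner_commute ereal_less_eq) argo
  qed
  finally show "ereal (1/2 * (norm (blinfun_apply B x - y))\<^sup>2)
      \<le> liminf (\<lambda>n. ereal (1/2 * (norm (blinfun_apply B (s n) - y))\<^sup>2))"
    by (simp only: w_def)
qed

lemma weakly_lsc_tikhonov:
  fixes B :: "'a::{real_inner, complete_space} \<Rightarrow>\<^sub>L 'b::real_inner"
  assumes \<alpha>: "\<alpha> > 0" and nonneg: "\<And>x. R x \<ge> 0" and lsc: "weakly_lsc R"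
  shows "weakly_lsc (tikhonov \<alpha> R y B)"
  unfolding weakly_lsc_def
proof (intro allI impI)
  fix s and x :: 'a assume s: "weakly_converges s x"
  let ?N = "\<lambda>x. ereal (1/2 * (norm (blinfun_apply B x - y))\<^sup>2)"
  have "?N x \<le> liminf (\<lambda>n. ?N (s n))"
    using weakly_lsc_residual[of B y] s unfolding weakly_lsc_def by blast
  moreover have "ereal \<alpha> * R x \<le> ereal \<alpha> * liminf (\<lambda>n. R (s n))"
    using lsc s \<alpha> unfolding weakly_lsc_def by (intro ereal_mult_left_mono) auto
  moreover have "ereal \<alpha> * liminf (\<lambda>n. R (s n)) = liminf (\<lambda>n. ereal \<alpha> * R (s n))"
    using \<alpha> by (intro Liminf_ereal_mult_left[symmetric]) auto
  ultimately have "tikhonov \<alpha> R y B x \<le> liminf (\<lambda>n. ?N (s n)) + liminf (\<lambda>n. ereal \<alpha> * R (s n))"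
    unfolding tikhonov_def by (metis add_mono)
  also have "\<dots> \<le> liminf (\<lambda>n. tikhonov \<alpha> R y B (s n))"
    unfolding tikhonov_def using \<alpha> nonneg by (intro Liminf_add_le) auto
  finally show "tikhonov \<alpha> R y B x \<le> liminf (\<lambda>n. tikhonov \<alpha> R y B (s n))" .
qed

section \<open>Minimizers of Tikhonov functionals\<close>

lemma tikhonov_minimizer_exists:
  fixes B :: "'a::{real_inner, complete_space} \<Rightarrow>\<^sub>L 'b::real_inner"
  assumes \<alpha>: "\<alpha> > 0" and nonneg: "\<And>x. R x \<ge> 0" and lsc: "weakly_lsc R"
    and coer: "coercive R" and fin: "\<exists>x. R x \<noteq> \<infinity>"
  obtains x where "is_arg_min (tikhonov \<alpha> R y B) (\<lambda>_. True) x"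
proof -
  let ?T = "tikhonov \<alpha> R y B"
  obtain z where "R z \<noteq> \<infinity>" using fin by blast
  then obtain q where z: "R z = ereal q" using nonneg[of z] by (cases "R z") auto
  define c where "c = 1/2 * (norm (blinfun_apply B z - y))\<^sup>2 + \<alpha> * q"
  have Tz: "?T z = ereal c" by (simp add: tikhonov_def z c_def)
  have "{x. ?T x \<le> ereal c} \<subseteq> {x. R x \<le> ereal (c / \<alpha>)}"
  proof safe
    fix x assume x: "?T x \<le> ereal c"
    show "R x \<le> ereal (c / \<alpha>)"
    proof (cases "R x")
      case (real p)
      have "0 \<le> 1/2 * (norm (blinfun_apply B x - y))\<^sup>2" by simp
      moreover have "1/2 * (norm (blinfun_apply B x - y))\<^sup>2 + \<alpha> * p \<le> c"
        using x by (simp add: tikhonov_def real)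
      ultimately have "\<alpha> * p \<le> c" by linarith
      then show ?thesis using \<alpha> by (simp add: real field_simps)
    next
      case PInf then show ?thesis using x \<alpha> by (simp add: tikhonov_def)
    next
      case MInf then show ?thesis by simp
    qed
  qed
  then have "bounded {x. ?T x \<le> ereal c}"
    using coercive_imp_bounded_sublevel[OF coer] bounded_subset by blast
  then obtain x where x: "?T x \<le> ereal c" "\<And>z. ?T z \<le> ereal c \<Longrightarrow> ?T x \<le> ?T z"
    using weakly_lsc_imp_minimizer_on_sublevel[OF weakly_lsc_tikhonov[OF \<alpha> nonneg lsc, of y B]
        weakly_lsc_tikhonov[OF \<alpha> nonneg lsc, of y B], of "ereal c" z] Tz by auto
  have "?T x \<le> ?T z" for z using x by (metis linear order_trans)
  then show thesis by (intro that[of x]) (auto simp: is_arg_min_def not_less)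
qed

lemma nonneg_if_nonneg_perturbed:
  fixes c k :: real
  assumes "\<And>t. 0 < t \<Longrightarrow> t < 1 \<Longrightarrow> 0 \<le> c + t * k"
  shows "0 \<le> c"
proof -
  have "(\<lambda>n. c + inverse (real (Suc n)) * k) \<longlonglongrightarrow> c + 0 * k"
    by (intro tendsto_intros LIMSEQ_inverse_real_of_nat)
  then have "(\<lambda>n. c + inverse (real (Suc n)) * k) \<longlonglongrightarrow> c" by simp
  moreover have "\<exists>N. \<forall>n\<ge>N. 0 \<le> c + inverse (real (Suc n)) * k"
    by (intro exI[of _ 1] allI impI assms) (auto simp: inverse_less_1_iff)
  ultimately show ?thesis by (rule LIMSEQ_le_const)
qed

text \<open>Optimality condition: \<open>x\<close> minimizes the Tikhonov functional iff \<open>B\<^sup>* (y - B x) / \<alpha>\<close> is a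
  subgradient of \<open>R\<close> at \<open>x\<close>. The adjoint is expressed by its defining identity.\<close>

lemma tikhonov_minimizer_iff:
  fixes B :: "'a::{real_inner, complete_space} \<Rightarrow>\<^sub>L 'b::real_inner"
  assumes \<alpha>: "\<alpha> > 0" and nonneg: "\<And>x. R x \<ge> 0" and conv: "convex_functional R"
    and fin: "\<exists>x. R x \<noteq> \<infinity>"
  shows "is_arg_min (tikhonov \<alpha> R y B) (\<lambda>_. True) x \<longleftrightarrow>
    (\<exists>v\<in>subdifferential R x. \<forall>u. \<alpha> * (v \<bullet> u) = (y - blinfun_apply B x) \<bullet> blinfun_apply B u)"
    (is "?L \<longleftrightarrow> ?R")
proof
  let ?T = "tikhonov \<alpha> R y B"
  have not_MInf: "R z \<noteq> -\<infinity>" for z using nonneg[of z] by auto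
  \<comment> \<open>Quadratic expansion of the data term along the segment from \<open>x\<close> to \<open>z\<close>; convexity of \<open>R\<close> on the
    segment and \<open>t \<rightarrow> 0\<close> turn minimality into the subgradient inequality.\<close>
  have expand: "1/2 * (norm (blinfun_apply B (x + t *\<^sub>R (z - x)) - y))\<^sup>2
      = 1/2 * (norm (blinfun_apply B x - y))\<^sup>2 - t * ((y - blinfun_apply B x) \<bullet> blinfun_apply B (z - x))
        + t * (t * (1/2 * (norm (blinfun_apply B (z - x)))\<^sup>2))" for t z
  proof -
    define d where "d = blinfun_apply B (z - x)"
    have "blinfun_apply B (x + t *\<^sub>R (z - x)) = blinfun_apply B x + t *\<^sub>R d"
      by (simp add: d_def blinfun.add_right blinfun.scaleR_right)
    then show ?thesis unfolding d_def[symmetric] power2_norm_eq_inner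
      by (simp add: inner_simps inner_commute algebra_simps)
  qed
  {
    assume ?L
    then have min: "?T x \<le> ?T z" for z by (auto simp: is_arg_min_def not_less)
    obtain z0 where z0: "R z0 \<noteq> \<infinity>" using fin by blast
    have "R x \<noteq> \<infinity>"
      using min[of z0] z0 not_MInf[of z0] \<alpha> by (cases "R z0") (auto simp: tikhonov_def)
    then obtain p where p: "R x = ereal p" using not_MInf by (cases "R x") auto
    have "bounded_linear (\<lambda>u. (1 / \<alpha>) *\<^sub>R ((y - blinfun_apply B x) \<bullet> blinfun_apply B u))"
      by (intro bounded_linear_scaleR_right[THEN bounded_linear_compose]
          bounded_linear_inner_right_comp blinfun.bounded_linear_right)
    then obtain v where v: "\<And>u. (1 / \<alpha>) *\<^sub>R ((y - blinfun_apply B x) \<bullet> blinfun_apply B u) = v \<bullet> u"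
      by (rule riesz_representation) blast
    have v': "\<alpha> * (v \<bullet> u) = (y - blinfun_apply B x) \<bullet> blinfun_apply B u" for u
      using v[of u, symmetric] \<alpha> by simp
    have "R z \<ge> R x + ereal (v \<bullet> (z - x))" for z
    proof (cases "R z")
      case (real q)
      let ?c = "\<alpha> * (q - p) - (y - blinfun_apply B x) \<bullet> blinfun_apply B (z - x)"
      have "0 \<le> ?c + t * (1/2 * (norm (blinfun_apply B (z - x)))\<^sup>2)" if t: "0 < t" "t < 1" for t
      proof -
        have eq: "(1 - t) *\<^sub>R x + t *\<^sub>R z = x + t *\<^sub>R (z - x)" by (simp add: algebra_simps)
        have "R (x + t *\<^sub>R (z - x)) \<le> ereal (1 - t) * R x + ereal t * R z"
          using conv t unfolding convex_functional_def eq[symmetric] by blast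
        then have "R (x + t *\<^sub>R (z - x)) \<le> ereal ((1 - t) * p + t * q)" by (simp add: p real)
        then obtain h where h: "R (x + t *\<^sub>R (z - x)) = ereal h" "h \<le> (1 - t) * p + t * q"
          using not_MInf[of "x + t *\<^sub>R (z - x)"] by (cases "R (x + t *\<^sub>R (z - x))") auto
        have "1/2 * (norm (blinfun_apply B x - y))\<^sup>2 + \<alpha> * p
            \<le> 1/2 * (norm (blinfun_apply B (x + t *\<^sub>R (z - x)) - y))\<^sup>2 + \<alpha> * h"
          using min[of "x + t *\<^sub>R (z - x)"] by (simp only: tikhonov_def p h times_ereal.simps plus_ereal.simps ereal_less_eq)
        moreover have "\<alpha> * h \<le> \<alpha> * ((1 - t) * p + t * q)" using h \<alpha> by simp
        moreover have "\<alpha> * ((1 - t) * p + t * q) = \<alpha> * p + t * (\<alpha> * (q - p))"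
          by (simp add: algebra_simps)
        ultimately have "0 \<le> t * (?c + t * (1/2 * (norm (blinfun_apply B (z - x)))\<^sup>2))"
          unfolding expand by (simp only: distrib_left right_diff_distrib)
        then show ?thesis using t by (simp add: zero_le_mult_iff)
      qed
      then have "0 \<le> ?c" by (rule nonneg_if_nonneg_perturbed)
      then have "\<alpha> * (v \<bullet> (z - x)) \<le> \<alpha> * (q - p)" by (simp add: v')
      then show ?thesis using \<alpha> by (simp add: p real)
    qed (use not_MInf in auto)
    then show ?R using p v' by (intro bexI[of _ v]) (auto simp: subdifferential_def)
  }
  assume ?R
  then obtain v where v: "v \<in> subdifferential R x"
    "\<And>u. \<alpha> * (v \<bullet> u) = (y - blinfun_apply B x) \<bullet> blinfun_apply B u" by blast
  from v(1) have sub: "\<And>z. R z \<ge> R x + ereal (v \<bullet> (z - x))" and "R x < \<infinity>"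
    by (auto simp: subdifferential_def split: if_splits)
  then obtain p where p: "R x = ereal p" using not_MInf by (cases "R x") auto
  have "?T x \<le> ?T z" for z
  proof (cases "R z")
    case (real q)
    have "v \<bullet> (z - x) \<le> q - p" using sub[of z] by (simp add: p real)
    then have "\<alpha> * (v \<bullet> (z - x)) \<le> \<alpha> * (q - p)" using \<alpha> by simp
    then have "(y - blinfun_apply B x) \<bullet> blinfun_apply B (z - x) \<le> \<alpha> * q - \<alpha> * p"
      by (simp add: v(2) right_diff_distrib)
    moreover have "0 \<le> 1/2 * (norm (blinfun_apply B (z - x)))\<^sup>2" by simp
    moreover have "1/2 * (norm (blinfun_apply B z - y))\<^sup>2
        = 1/2 * (norm (blinfun_apply B x - y))\<^sup>2 - (y - blinfun_apply B x) \<bullet> blinfun_apply B (z - x)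
          + 1/2 * (norm (blinfun_apply B (z - x)))\<^sup>2"
      using expand[of 1 z] by simp
    ultimately have "1/2 * (norm (blinfun_apply B x - y))\<^sup>2 + \<alpha> * p
        \<le> 1/2 * (norm (blinfun_apply B z - y))\<^sup>2 + \<alpha> * q"
      by linarith
    then show ?thesis
      by (simp only: tikhonov_def p real times_ereal.simps plus_ereal.simps ereal_less_eq)
  qed (use not_MInf \<alpha> in \<open>auto simp: tikhonov_def\<close>)
  then show ?L by (auto simp: is_arg_min_def not_less)
qed

section \<open>Feasible points\<close>

text \<open>Feasibility does not mention the operators: with \<open>w = B x\<close>, optimality gives
  \<open>\<alpha> \<langle>v, x\<rangle> = \<langle>y - w, w\<rangle> \<le> \<parallel>y\<parallel>\<^sup>2 / 4\<close>, and conversely a rank-one operator realizes every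
  subgradient \<open>v\<close> satisfying this bound.\<close>

lemma adp_feasible_iff_subgradient:
  fixes R :: "'a::{real_inner, complete_space} \<Rightarrow> ereal" and y :: "'b::real_inner"
  assumes y: "y \<noteq> 0" and \<alpha>: "\<alpha> > 0" and nonneg: "\<And>x. R x \<ge> 0" and conv: "convex_functional R"
    and fin: "\<exists>x. R x \<noteq> \<infinity>"
  shows "adp_feasible \<alpha> R y x \<longleftrightarrow> (\<exists>v\<in>subdifferential R x. v \<bullet> x \<le> (norm y)\<^sup>2 / (4 * \<alpha>))"
proof
  note opt = tikhonov_minimizer_iff[OF \<alpha> nonneg conv fin]
  {
    assume "adp_feasible \<alpha> R y x"
    then obtain B :: "'a \<Rightarrow>\<^sub>L 'b" and v where v: "v \<in> subdifferential R x"
      and *: "\<And>u. \<alpha> * (v \<bullet> u) = (y - blinfun_apply B x) \<bullet> blinfun_apply B u"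
      unfolding adp_feasible_def opt by blast
    have "0 \<le> (norm (y - 2 *\<^sub>R blinfun_apply B x))\<^sup>2" by simp
    also have "\<dots> = (norm y)\<^sup>2 - 4 * ((y - blinfun_apply B x) \<bullet> blinfun_apply B x)"
      unfolding power2_norm_eq_inner by (simp add: inner_simps inner_commute)
    finally have "4 * (\<alpha> * (v \<bullet> x)) \<le> (norm y)\<^sup>2" by (simp add: *)
    then show "\<exists>v\<in>subdifferential R x. v \<bullet> x \<le> (norm y)\<^sup>2 / (4 * \<alpha>)"
      using v \<alpha> by (intro bexI[of _ v]) (simp_all add: field_simps)
  }
  assume "\<exists>v\<in>subdifferential R x. v \<bullet> x \<le> (norm y)\<^sup>2 / (4 * \<alpha>)"
  then obtain v where v: "v \<in> subdifferential R x" and le: "v \<bullet> x \<le> (norm y)\<^sup>2 / (4 * \<alpha>)" by blast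
  define N where "N = (norm y)\<^sup>2"
  have N: "N > 0" using y by (simp add: N_def)
  define c where "c = v \<bullet> x"
  have disc: "4 * \<alpha> * c \<le> N" using le \<alpha> by (simp add: N_def c_def field_simps)
  \<comment> \<open>For \<open>B u = s \<langle>v, u\<rangle> y\<close> the optimality condition is the quadratic equation
    \<open>s (1 - s c) \<parallel>y\<parallel>\<^sup>2 = \<alpha>\<close>, which has a real root by the bound on \<open>c\<close>.\<close>
  obtain s where s: "s * (1 - s * c) * N = \<alpha>"
  proof (cases "c = 0")
    case True
    then show thesis using N by (intro that[of "\<alpha> / N"]) simp
  next
    case False
    define D where "D = sqrt (1 - 4 * \<alpha> * c / N)"
    have "D * D = 1 - 4 * \<alpha> * c / N"
      unfolding D_def using disc N by (intro real_sqrt_mult_self[THEN trans] abs_of_nonneg) (simp add: field_simps)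
    then have "(1 - D) * (1 + D) * N = 4 * \<alpha> * c" using N by (simp add: field_simps)
    moreover have "(1 - D) / (2 * c) * (1 - (1 - D) / (2 * c) * c) * N
        = (1 - D) * (1 + D) * N / (4 * c)"
      using False by (simp add: field_simps)
    ultimately show thesis using False by (intro that[of "(1 - D) / (2 * c)"]) simp
  qed
  have "bounded_linear (\<lambda>u. (s * (v \<bullet> u)) *\<^sub>R y)"
    by (intro bounded_linear_scaleR_left[THEN bounded_linear_compose]
        bounded_linear_mult_right[THEN bounded_linear_compose] bounded_linear_inner_right)
  then have B: "blinfun_apply (Blinfun (\<lambda>u. (s * (v \<bullet> u)) *\<^sub>R y)) = (\<lambda>u. (s * (v \<bullet> u)) *\<^sub>R y)"
    by (rule bounded_linear_Blinfun_apply)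
  have "\<alpha> * (v \<bullet> u) = (y - (s * (v \<bullet> x)) *\<^sub>R y) \<bullet> ((s * (v \<bullet> u)) *\<^sub>R y)" for u
  proof -
    have "(y - (s * (v \<bullet> x)) *\<^sub>R y) \<bullet> ((s * (v \<bullet> u)) *\<^sub>R y) = s * (1 - s * c) * N * (v \<bullet> u)"
      by (simp add: N_def c_def power2_norm_eq_inner inner_simps algebra_simps)
    then show ?thesis unfolding s by (rule sym)
  qed
  with v show "adp_feasible \<alpha> R y x"
    unfolding adp_feasible_def opt
    by (intro exI[of _ "Blinfun (\<lambda>u. (s * (v \<bullet> u)) *\<^sub>R y)"] bexI[of _ v]) (simp_all add: B)
qed

lemma R_tilde_attained:
  assumes "R_tilde_well_defined R" and "R_tilde R x \<noteq> \<infinity>"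
  obtains v where "v \<in> subdifferential R x" and "R_tilde R x = ereal (v \<bullet> x)"
proof -
  have "subdifferential R x \<noteq> {}" using assms(2) by (auto simp: R_tilde_def top_ereal_def)
  then obtain v where v: "is_arg_min (\<lambda>w. w \<bullet> x) (\<lambda>w. w \<in> subdifferential R x) v"
    using assms(1) unfolding R_tilde_well_defined_def by blast
  then have "R_tilde R x = ereal (v \<bullet> x)"
    unfolding R_tilde_def by (intro antisym INF_lower INF_greatest) (auto simp: is_arg_min_linorder)
  with v show thesis by (intro that[of v]) (auto simp: is_arg_min_def)
qed

lemma adp_feasible_iff_R_tilde:
  fixes R :: "'a::{real_inner, complete_space} \<Rightarrow> ereal" and y :: "'b::real_inner"
  assumes "y \<noteq> 0" and "\<alpha> > 0" and "\<And>x. R x \<ge> 0" and "convex_functional R"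
    and "\<exists>x. R x \<noteq> \<infinity>" and wd: "R_tilde_well_defined R"
  shows "adp_feasible \<alpha> R y x \<longleftrightarrow> R_tilde R x \<le> ereal ((norm y)\<^sup>2 / (4 * \<alpha>))"
proof -
  let ?C = "(norm y)\<^sup>2 / (4 * \<alpha>)"
  have "(\<exists>v\<in>subdifferential R x. v \<bullet> x \<le> ?C) \<longleftrightarrow> R_tilde R x \<le> ereal ?C"
  proof
    assume "\<exists>v\<in>subdifferential R x. v \<bullet> x \<le> ?C"
    then show "R_tilde R x \<le> ereal ?C" unfolding R_tilde_def by (auto intro: INF_lower2)
  next
    assume le: "R_tilde R x \<le> ereal ?C"
    then have "R_tilde R x \<noteq> \<infinity>" by auto
    with wd obtain v where "v \<in> subdifferential R x" "R_tilde R x = ereal (v \<bullet> x)"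
      by (rule R_tilde_attained)
    with le show "\<exists>v\<in>subdifferential R x. v \<bullet> x \<le> ?C" by auto
  qed
  then show ?thesis using adp_feasible_iff_subgradient[OF assms(1-5)] by simp
qed

section \<open>The origin lies in the domain of the regularizer\<close>

text \<open>The minimizers \<open>x\<^sub>n\<close> of \<open>\<parallel>x\<parallel>\<^sup>2 / 2 + R x / (n + 1)\<close> are bounded and satisfy
  \<open>R_tilde R x\<^sub>n \<le> - (n + 1) \<parallel>x\<^sub>n\<parallel>\<^sup>2\<close>. As well-definedness keeps \<open>R_tilde R\<close> from taking the value \<open>-\<infinity>\<close>, semicontinuity
  along a weakly convergent subsequence forces \<open>x\<^sub>n \<longlonglongrightarrow> 0\<close> there, and a second use of it bounds
  \<open>R_tilde R 0\<close>.\<close>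

lemma R_tilde_zero_le:
  fixes R :: "'a::{real_inner, complete_space} \<Rightarrow> ereal"
  assumes nonneg: "\<And>x. R x \<ge> 0" and conv: "convex_functional R"
    and coer: "coercive R" and lsc: "weakly_lsc R" and fin: "\<exists>x. R x \<noteq> \<infinity>"
    and wd: "R_tilde_well_defined R" and tlsc: "weakly_lsc (R_tilde R)"
  shows "R_tilde R 0 \<le> 0"
proof -
  \<comment> \<open>These quadratic perturbations are Tikhonov functionals with the identity operator and data \<open>0\<close>,
    so existence and optimality of their minimizers are instances of the general results.\<close>
  let ?T = "\<lambda>n. tikhonov (inverse (real (Suc n))) R 0 (id_blinfun :: 'a \<Rightarrow>\<^sub>L 'a)"
  have pos: "inverse (real (Suc n)) > 0" for n by simp
  have "\<exists>x. is_arg_min (?T n) (\<lambda>_. True) x" for n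
    using tikhonov_minimizer_exists[OF pos nonneg lsc coer fin] by blast
  then obtain s where s: "\<And>n. is_arg_min (?T n) (\<lambda>_. True) (s n)" by metis
  have tilde_s: "R_tilde R (s n) \<le> ereal (- (real (Suc n) * (norm (s n))\<^sup>2))" for n
  proof -
    obtain v where v: "v \<in> subdifferential R (s n)"
      "\<And>u. inverse (real (Suc n)) * (v \<bullet> u) = (0 - s n) \<bullet> u"
      using s[of n] unfolding tikhonov_minimizer_iff[OF pos nonneg conv fin] by auto
    have "v \<bullet> s n = real (Suc n) * (inverse (real (Suc n)) * (v \<bullet> s n))" by simp
    also have "\<dots> = - (real (Suc n) * (norm (s n))\<^sup>2)"
      unfolding v(2) by (simp add: power2_norm_eq_inner)
    finally have "v \<bullet> s n = - (real (Suc n) * (norm (s n))\<^sup>2)" .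
    then show ?thesis unfolding R_tilde_def by (intro INF_lower2[OF v(1)]) simp
  qed
  obtain z where "R z \<noteq> \<infinity>" using fin by blast
  then obtain q where z: "R z = ereal q" "q \<ge> 0" using nonneg[of z] by (cases "R z") auto
  have "(norm (s n))\<^sup>2 \<le> (norm z)\<^sup>2 + 2 * q" for n
  proof -
    have "?T n (s n) \<le> ?T n z" using s[of n] by (auto simp: is_arg_min_def not_less)
    also have "\<dots> = ereal (1/2 * (norm z)\<^sup>2 + inverse (real (Suc n)) * q)"
      by (simp add: tikhonov_def z)
    also have "inverse (real (Suc n)) * q \<le> 1 * q"
      using z(2) by (intro mult_right_mono) (auto simp: inverse_le_1_iff)
    finally have "?T n (s n) \<le> ereal (1/2 * (norm z)\<^sup>2 + q)" by simp
    moreover have "ereal (1/2 * (norm (s n))\<^sup>2) + 0 \<le> ?T n (s n)"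
      unfolding tikhonov_def using nonneg by (intro add_mono) auto
    ultimately have "ereal (1/2 * (norm (s n))\<^sup>2) + 0 \<le> ereal (1/2 * (norm z)\<^sup>2 + q)"
      by (rule order_trans[rotated])
    then show ?thesis by simp
  qed
  then have "norm (s n) \<le> sqrt ((norm z)\<^sup>2 + 2 * q)" for n by (rule real_le_rsqrt)
  then have "bounded (range s)" by (auto simp: bounded_iff)
  then obtain r x where r: "strict_mono r" and x: "weakly_converges (s \<circ> r) x"
    by (rule bounded_imp_weakly_convergent_subsequence)
  have le_lim: "R_tilde R x \<le> liminf (\<lambda>n. R_tilde R ((s \<circ> r) n))"
    using tlsc x unfolding weakly_lsc_def by blast
  have "R_tilde R x \<noteq> -\<infinity>" using R_tilde_attained[OF wd, of x] by fastforce
  then obtain c where c: "ereal c < R_tilde R x"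
    using lt_ex[of "real_of_ereal (R_tilde R x)"] by (cases "R_tilde R x") auto
  then have "\<forall>\<^sub>F n in sequentially. ereal c < R_tilde R ((s \<circ> r) n)"
    using le_lim unfolding le_Liminf_iff by blast
  then have "\<forall>\<^sub>F n in sequentially. norm ((norm ((s \<circ> r) n))\<^sup>2) \<le> \<bar>c\<bar> * inverse (real (Suc n))"
  proof eventually_elim
    case (elim n)
    have "ereal c < ereal (- (real (Suc (r n)) * (norm (s (r n)))\<^sup>2))"
      using elim tilde_s[of "r n"] unfolding o_def by (rule less_le_trans)
    then have "real (Suc (r n)) * (norm (s (r n)))\<^sup>2 \<le> \<bar>c\<bar>" by simp
    moreover have "real (Suc n) * (norm (s (r n)))\<^sup>2 \<le> real (Suc (r n)) * (norm (s (r n)))\<^sup>2"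
      using seq_suble[OF r, of n] by (intro mult_right_mono) auto
    ultimately have "real (Suc n) * (norm (s (r n)))\<^sup>2 \<le> \<bar>c\<bar>" by linarith
    then show ?case by (simp add: field_simps)
  qed
  moreover have "(\<lambda>n. \<bar>c\<bar> * inverse (real (Suc n))) \<longlonglongrightarrow> 0"
    using tendsto_mult_right_zero[OF LIMSEQ_inverse_real_of_nat] .
  ultimately have "(\<lambda>n. (norm ((s \<circ> r) n))\<^sup>2) \<longlonglongrightarrow> 0" by (rule Lim_null_comparison)
  then have "(\<lambda>n. sqrt ((norm ((s \<circ> r) n))\<^sup>2)) \<longlonglongrightarrow> sqrt 0" by (rule tendsto_real_sqrt)
  then have "(s \<circ> r) \<longlonglongrightarrow> 0" by (simp add: tendsto_norm_zero_iff o_def)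
  then have "weakly_converges (s \<circ> r) 0"
    unfolding weakly_converges_def by (intro allI tendsto_intros)
  then have "R_tilde R 0 \<le> liminf (\<lambda>n. R_tilde R ((s \<circ> r) n))"
    using tlsc unfolding weakly_lsc_def by blast
  also have "\<dots> \<le> liminf (\<lambda>n. 0)"
  proof (intro Liminf_mono always_eventually allI)
    fix n
    have "ereal (- (real (Suc (r n)) * (norm (s (r n)))\<^sup>2)) \<le> 0" by simp
    then show "R_tilde R ((s \<circ> r) n) \<le> 0" using tilde_s[of "r n"] order_trans by fastforce
  qed
  finally show ?thesis by (simp add: Liminf_const)
qed

text \<open>The subgradient inequality tested at the origin gives \<open>R x \<le> R 0 + \<langle>v, x\<rangle>\<close>; finiteness of
  \<open>R_tilde R 0\<close> serves only to make \<open>R 0\<close> finite.\<close>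

lemma bounded_R_tilde_sublevel:
  assumes nonneg: "\<And>x. R x \<ge> 0" and coer: "coercive R"
    and wd: "R_tilde_well_defined R" and zero: "R_tilde R 0 \<noteq> \<infinity>"
  shows "bounded {x. R_tilde R x \<le> ereal c}"
proof -
  obtain v0 where "v0 \<in> subdifferential R 0" using wd zero by (rule R_tilde_attained)
  then have "R 0 < \<infinity>" by (simp add: subdifferential_def split: if_splits)
  then obtain p where p: "R 0 = ereal p" using nonneg[of 0] by (cases "R 0") auto
  have "{x. R_tilde R x \<le> ereal c} \<subseteq> {x. R x \<le> ereal (p + c)}"
  proof safe
    fix x assume le: "R_tilde R x \<le> ereal c"
    then have "R_tilde R x \<noteq> \<infinity>" by auto
    with wd obtain v where v: "v \<in> subdifferential R x" "R_tilde R x = ereal (v \<bullet> x)"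
      by (rule R_tilde_attained)
    have "\<forall>z. R z \<ge> R x + ereal (v \<bullet> (z - x))"
      using v(1) unfolding subdifferential_def by (simp split: if_splits)
    then have "R 0 \<ge> R x + ereal (v \<bullet> (0 - x))" by blast
    then show "R x \<le> ereal (p + c)" using le v(2) by (cases "R x") (auto simp: p)
  qed
  then show ?thesis using coercive_imp_bounded_sublevel[OF coer] bounded_subset by blast
qed

section \<open>Existence of a solution\<close>

theorem mainTheorem5:
  fixes A :: "'a::{real_inner, complete_space} \<Rightarrow>\<^sub>L 'b::{real_inner, complete_space}"
    and y :: 'b and \<alpha> :: real and R :: "'a \<Rightarrow> ereal"
  assumes "y \<noteq> 0" and "\<alpha> > 0"
    and "\<And>x. R x \<ge> 0"
    and "convex_functional R"
    and "coercive R"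
    and "weakly_lsc R"
    and "\<exists>x. R x \<noteq> \<infinity>"
    and "R_tilde_well_defined R"
    and "weakly_lsc (R_tilde R)"
  shows "\<exists>x. adp_solution A \<alpha> R y x"
proof -
  let ?C = "ereal ((norm y)\<^sup>2 / (4 * \<alpha>))"
  have zero: "R_tilde R 0 \<le> 0" by (rule R_tilde_zero_le[OF assms(3-9)])
  then have "R_tilde R 0 \<noteq> \<infinity>" by auto
  then have bdd: "bounded {x. R_tilde R x \<le> ?C}"
    by (rule bounded_R_tilde_sublevel[OF assms(3,5,8)])
  have "0 \<le> ?C" using \<open>\<alpha> > 0\<close> by simp
  with zero have "R_tilde R 0 \<le> ?C" by (rule order_trans)
  with weakly_lsc_residual[of A y] \<open>weakly_lsc (R_tilde R)\<close> bdd obtain x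
    where "R_tilde R x \<le> ?C"
      and "\<And>z. R_tilde R z \<le> ?C \<Longrightarrow> ereal (1/2 * (norm (blinfun_apply A x - y))\<^sup>2)
              \<le> ereal (1/2 * (norm (blinfun_apply A z - y))\<^sup>2)"
    by (rule weakly_lsc_imp_minimizer_on_sublevel) blast
  then have "adp_solution A \<alpha> R y x"
    unfolding adp_solution_def is_arg_min_linorder
      adp_feasible_iff_R_tilde[OF assms(1-4,7,8)]
    by (simp only: ereal_less_eq) blast
  then show ?thesis by blast
qed

end
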